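(* Let $K$ be an algebraically closed field with $\operatorname{char} K\neq2,3$. (1) Let $S(a,b,c)$ be a three-dimensional Sklyanin algebra of type EC over $K$. If $r,s\in S(a,b,c)_1$ are linearly independent and $rs=qsr$ for some $q\in K^*$, then $q=-1$ and $a=b$. (2) If the algebra $S(1,1,c)$ is of type EC, then there exist linearly independent $r,s\in S(1,1,c)_1$ with $rs=-sr$. More precisely, up to scaling in each component independently, the set of such pairs $(r,s)$ is in one-to-one correspondence with the closed points of the scheme $\Gamma(S(-c,-c,2))$.
   Context: For $a,b,c\in K$, $$S(a,b,c)=\frac{K\langle x,y,z\rangle}{\langle ayz+bzy+cx^2,\ azx+bxz+cy^2,\ axy+byx+cz^2\rangle},$$ graded with $x,y,z$ in degree 1. It is a three-dimensional Sklyanin algebra if $[a:b:c]\in\mathbb P^2$ is not in $\{[1:0:0],[0:1:0],[0:0:1]\}\cup\{[a:b:c]: a^3=b^3=c^3\}$, and it is of type EC if its point scheme, the zero scheme of $(a^3+b^3+c^3)xyz-abc(x^3+y^3+z^3)$ in $\mathbb P^2$, is an elliptic curve; equivalently $abc\neq0$ and $(3abc)^3\ne(a^3+b^3+c^3)^3$. For a quadratic algebra $A=T(V)/\langle R\rangle$, $\Gamma(A)\subseteq\mathbb P(V^* )\times\mathbb P(V^* )$ is the scheme of zeros of the multilinearizations of the elements of $R$. For $A=S(a,b,c)$, its closed points are the $([x_0:y_0:z_0],[x_1:y_1:z_1])\in\mathbb P^2\times\mathbb P^2$ with $ay_0z_1+bz_0y_1+cx_0x_1=az_0x_1+bx_0z_1+cy_0y_1=ax_0y_1+by_0x_1+cz_0z_1=0$.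 In (2), the correspondence sends a pair $(r,s)$ with $r=\alpha_1x+\beta_1y+\gamma_1z$, $s=\alpha_2x+\beta_2y+\gamma_2z$ to $([\alpha_1:\beta_1:\gamma_1],[\alpha_2:\beta_2:\gamma_2])$. *)

theory Defs
  imports
    "HOL-Analysis.Analysis"
    "HOL-Algebra.Embedded_Algebras"
    "HOL-Algebra.Algebraic_Closure_Type"
    "HOL-Library.Poly_Mapping"
begin

no_notation fps_nth (infixl \<open>$\<close> 75)

section \<open>Free algebras and their quotients\<close>

text \<open>
  Finitely supported functions on the free monoid of words, with the convolution product of
  \<^theory>\<open>HOL-Library.Poly_Mapping\<close>, form the free associative algebra. Words get their own type
  because that product needs the exponents to be of class \<^class>\<open>monoid_add\<close>.
\<close>

datatype 'v nc_word = NC_Word (letters: "'v list")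

instantiation nc_word :: (type) monoid_add
begin

definition zero_nc_word :: "'a nc_word"
  where "0 = NC_Word []"

definition plus_nc_word :: "'a nc_word \<Rightarrow> 'a nc_word \<Rightarrow> 'a nc_word"
  where "u + w = NC_Word (letters u @ letters w)"

instance
  by standard (simp_all add: zero_nc_word_def plus_nc_word_def)

end

type_synonym ('v, 'k) free_alg = "'v nc_word \<Rightarrow>\<^sub>0 'k"

definition fconst :: "'k::field \<Rightarrow> ('v, 'k) free_alg"
  where "fconst k = Poly_Mapping.single 0 k"

definition fvar :: "'v \<Rightarrow> ('v, 'k::field) free_alg"
  where "fvar i = Poly_Mapping.single (NC_Word [i]) 1"

definition homogeneous :: "nat \<Rightarrow> ('v, 'k::field) free_alg \<Rightarrow> bool"
  where "homogeneous n f \<longleftrightarrow> (\<forall>w \<in> Poly_Mapping.keys f. length (letters w) = n)"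

abbreviation free_ring :: "('v, 'k::field) free_alg ring"
  where "free_ring \<equiv> ring_of_type_algebra"

text \<open>
  Ideals of HOL-Algebra are two-sided, so \<open>pres_alg R\<close> is \<open>K\<langle>v | v \<in> 'v\<rangle> / \<langle>R\<rangle>\<close>.
\<close>

definition pres_alg :: "('v, 'k::field) free_alg set \<Rightarrow> ('v, 'k) free_alg set ring"
  where "pres_alg R = free_ring Quot (Idl\<^bsub>free_ring\<^esub> R)"

definition pres_class :: "('v, 'k::field) free_alg set \<Rightarrow> ('v, 'k) free_alg \<Rightarrow> ('v, 'k) free_alg set"
  where "pres_class R f = (Idl\<^bsub>free_ring\<^esub> R) +>\<^bsub>free_ring\<^esub> f"

definition pres_scalar :: "('v, 'k::field) free_alg set \<Rightarrow> 'k \<Rightarrow> ('v, 'k) free_alg set"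
  where "pres_scalar R k = pres_class R (fconst k)"

text \<open>The degree \<open>n\<close> component, for homogeneous relations \<open>R\<close>.\<close>

definition pres_degree :: "('v, 'k::field) free_alg set \<Rightarrow> nat \<Rightarrow> ('v, 'k) free_alg set set"
  where "pres_degree R n = pres_class R ` {f. homogeneous n f}"

text \<open>Linear independence over the image of \<open>K\<close> in the algebra.\<close>

definition pres_independent ::
  "('v, 'k::field) free_alg set \<Rightarrow> ('v, 'k) free_alg set list \<Rightarrow> bool"
  where "pres_independent R us \<longleftrightarrow> ring.independent (pres_alg R) (range (pres_scalar R)) us"

definition pres_linform ::
  "('v, 'k::field) free_alg set \<Rightarrow> 'k ^ 'v \<Rightarrow> ('v::finite, 'k) free_alg set"
  where "pres_linform R p = pres_class R (\<Sum>i\<in>UNIV. fconst (p $ i) * fvar i)"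


section \<open>The scheme \<open>\<Gamma>\<close> of a quadratic algebra\<close>

text \<open>The point \<open>[v]\<close> of projective space is the line spanned by \<open>v \<noteq> 0\<close>, with the origin removed.\<close>

definition proj_pt :: "'k::field ^ 'v \<Rightarrow> ('k ^ 'v) set"
  where "proj_pt v = {t *s v | t. t \<noteq> 0}"

definition multilinearization ::
  "('v::finite, 'k::field) free_alg \<Rightarrow> 'k ^ 'v \<Rightarrow> 'k ^ 'v \<Rightarrow> 'k"
  where "multilinearization f p q =
    (\<Sum>i\<in>UNIV. \<Sum>j\<in>UNIV. Poly_Mapping.lookup f (NC_Word [i, j]) * p $ i * q $ j)"

text \<open>
  The closed points of \<open>\<Gamma>\<close> over an algebraically closed field. Points of \<open>\<P>(V\<^sup>*)\<close> are given by their
  coordinates with respect to the basis of \<open>V\<^sup>*\<close> dual to the variables.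
\<close>

definition Gamma_points :: "('v::finite, 'k::field) free_alg set \<Rightarrow> (('k ^ 'v) set \<times> ('k ^ 'v) set) set"
  where "Gamma_points R =
    {(proj_pt p, proj_pt q) | p q. p \<noteq> 0 \<and> q \<noteq> 0 \<and> (\<forall>f\<in>R. multilinearization f p q = 0)}"


section \<open>Sklyanin algebras\<close>

text \<open>The variables \<open>x\<close>, \<open>y\<close>, \<open>z\<close> are indexed by \<open>1\<close>, \<open>2\<close>, \<open>3\<close> of the three-element type \<open>3\<close>.\<close>

definition sklyanin_rels :: "'k::field \<Rightarrow> 'k \<Rightarrow> 'k \<Rightarrow> (3, 'k) free_alg set"
  where "sklyanin_rels a b c =
    (let x = fvar 1; y = fvar 2; z = fvar 3 in
      {fconst a * y * z + fconst b * z * y + fconst c * x ^ 2,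
       fconst a * z * x + fconst b * x * z + fconst c * y ^ 2,
       fconst a * x * y + fconst b * y * x + fconst c * z ^ 2})"

definition is_sklyanin :: "'k::field \<Rightarrow> 'k \<Rightarrow> 'k \<Rightarrow> bool"
  where "is_sklyanin a b c \<longleftrightarrow>
    vector [a, b, c] \<noteq> (0 :: 'k ^ 3) \<and>
    proj_pt (vector [a, b, c] :: 'k ^ 3) \<notin>
      {proj_pt (vector [1, 0, 0]), proj_pt (vector [0, 1, 0]), proj_pt (vector [0, 0, 1])} \<and>
    \<not> (a ^ 3 = b ^ 3 \<and> b ^ 3 = c ^ 3)"

text \<open>
  The form \<open>(a\<^sup>3 + b\<^sup>3 + c\<^sup>3) x y z - a b c (x\<^sup>3 + y\<^sup>3 + z\<^sup>3)\<close>. It is stated over an arbitrary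
  commutative ring so that it can also be evaluated at polynomials, to form derivatives.
\<close>

definition point_cubic :: "'r::comm_ring_1 \<Rightarrow> 'r \<Rightarrow> 'r \<Rightarrow> 'r \<Rightarrow> 'r \<Rightarrow> 'r \<Rightarrow> 'r"
  where "point_cubic a b c x y z =
    (a ^ 3 + b ^ 3 + c ^ 3) * x * y * z - a * b * c * (x ^ 3 + y ^ 3 + z ^ 3)"

text \<open>The derivative of a polynomial function \<open>\<phi>\<close> at \<open>t\<close> is that of \<open>\<phi>(t + T)\<close> at \<open>T = 0\<close>.\<close>

definition point_cubic_grad :: "'k::field \<Rightarrow> 'k \<Rightarrow> 'k \<Rightarrow> 'k \<Rightarrow> 'k \<Rightarrow> 'k \<Rightarrow> 'k \<times> 'k \<times> 'k"
  where "point_cubic_grad a b c x y z =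
    (poly (pderiv (point_cubic [:a:] [:b:] [:c:] [:x, 1:] [:y:] [:z:])) 0,
     poly (pderiv (point_cubic [:a:] [:b:] [:c:] [:x:] [:y, 1:] [:z:])) 0,
     poly (pderiv (point_cubic [:a:] [:b:] [:c:] [:x:] [:y:] [:z, 1:])) 0)"

text \<open>
  The zero scheme of a ternary cubic form over an algebraically closed field is an elliptic curve
  iff it has no singular point, i.e. iff the form and its gradient have no common zero in \<open>\<P>\<^sup>2\<close>.
\<close>

definition point_scheme_elliptic :: "'k::field \<Rightarrow> 'k \<Rightarrow> 'k \<Rightarrow> bool"
  where "point_scheme_elliptic a b c \<longleftrightarrow>
    \<not> (\<exists>x y z. (x, y, z) \<noteq> (0, 0, 0) \<and> point_cubic a b c x y z = 0 \<and>
          point_cubic_grad a b c x y z = (0, 0, 0))"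

definition is_type_EC :: "'k::field \<Rightarrow> 'k \<Rightarrow> 'k \<Rightarrow> bool"
  where "is_type_EC a b c \<longleftrightarrow> is_sklyanin a b c \<and> point_scheme_elliptic a b c"


section \<open>Anticommuting pairs of linear forms\<close>

definition anticomm_pairs ::
  "('v, 'k::field) free_alg set \<Rightarrow> (('v, 'k) free_alg set \<times> ('v, 'k) free_alg set) set"
  where "anticomm_pairs R =
    {(r, s). r \<in> pres_degree R 1 \<and> s \<in> pres_degree R 1 \<and> pres_independent R [r, s] \<and>
       r \<otimes>\<^bsub>pres_alg R\<^esub> s = \<ominus>\<^bsub>pres_alg R\<^esub> (s \<otimes>\<^bsub>pres_alg R\<^esub> r)}"

definition pair_scaling ::
  "('v, 'k::field) free_alg set \<Rightarrow> (('v, 'k) free_alg set \<times> ('v, 'k) free_alg set) rel"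
  where "pair_scaling R =
    {((r, s), (r', s')). (r, s) \<in> anticomm_pairs R \<and> (r', s') \<in> anticomm_pairs R \<and>
       (\<exists>k l. k \<noteq> 0 \<and> l \<noteq> 0 \<and>
          r' = pres_scalar R k \<otimes>\<^bsub>pres_alg R\<^esub> r \<and> s' = pres_scalar R l \<otimes>\<^bsub>pres_alg R\<^esub> s)}"


section \<open>Explicit forms of the definitions\<close>

lemma point_cubic_grad_eq:
  "point_cubic_grad a b c x y z =
    ((a ^ 3 + b ^ 3 + c ^ 3) * y * z - 3 * a * b * c * x ^ 2,
     (a ^ 3 + b ^ 3 + c ^ 3) * x * z - 3 * a * b * c * y ^ 2,
     (a ^ 3 + b ^ 3 + c ^ 3) * x * y - 3 * a * b * c * z ^ 2)"
  by (simp add: point_cubic_grad_def point_cubic_def pderiv_diff pderiv_mult pderiv_add pderiv_pCons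
      power3_eq_cube power2_eq_square algebra_simps)

lemma Gamma_points_sklyanin:
  fixes a b c :: "'k::field"
  shows "Gamma_points (sklyanin_rels a b c) =
    {(proj_pt p, proj_pt q) | p q. p \<noteq> 0 \<and> q \<noteq> 0 \<and>
       a * p $ 2 * q $ 3 + b * p $ 3 * q $ 2 + c * p $ 1 * q $ 1 = 0 \<and>
       a * p $ 3 * q $ 1 + b * p $ 1 * q $ 3 + c * p $ 2 * q $ 2 = 0 \<and>
       a * p $ 1 * q $ 2 + b * p $ 2 * q $ 1 + c * p $ 3 * q $ 3 = 0}"
  unfolding Gamma_points_def sklyanin_rels_def multilinearization_def
  by (simp add: sum_3 Let_def fconst_def fvar_def power2_eq_square mult_single lookup_add
      lookup_single plus_nc_word_def zero_nc_word_def add_ac)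

lemma point_scheme_elliptic_iff:
  fixes a b c :: "'k::alg_closed_field"
  assumes "CHAR('k) \<noteq> 3"
  shows "point_scheme_elliptic a b c \<longleftrightarrow>
    a * b * c \<noteq> 0 \<and> (3 * a * b * c) ^ 3 \<noteq> (a ^ 3 + b ^ 3 + c ^ 3) ^ 3"
proof -
  have three: "(3::'k) \<noteq> 0"
  proof
    assume "(3::'k) = 0"
    then have "of_nat 3 = (0::'k)" by simp
    then have "CHAR('k) dvd 3" by (simp only: of_nat_eq_0_iff_char_dvd)
    moreover have "Factorial_Ring.prime (3::nat)" by simp
    moreover have "CHAR('k) \<noteq> 1" by simp
    ultimately show False using assms by (metis prime_nat_iff)
  qed
  define l m where "l = a ^ 3 + b ^ 3 + c ^ 3" and "m = a * b * c"
  have cub: "point_cubic a b c x y z = l * x * y * z - m * (x ^ 3 + y ^ 3 + z ^ 3)" for x y z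
    by (simp add: point_cubic_def l_def m_def)
  have grd: "point_cubic_grad a b c x y z =
      (l * y * z - 3 * m * x ^ 2, l * x * z - 3 * m * y ^ 2, l * x * y - 3 * m * z ^ 2)" for x y z
    by (simp add: point_cubic_grad_eq l_def m_def mult.assoc)
  have "m \<noteq> 0 \<and> (3 * m) ^ 3 \<noteq> l ^ 3" if ell: "point_scheme_elliptic a b c"
  proof (intro conjI notI)
    assume "m = 0"
    then have "point_cubic a b c 1 0 0 = 0 \<and> point_cubic_grad a b c 1 0 0 = (0, 0, 0)"
      by (simp add: cub grd)
    with ell show False unfolding point_scheme_elliptic_def by (metis prod.inject zero_neq_one)
  next
    assume eq: "(3 * m) ^ 3 = l ^ 3"
    show False
    proof (cases "m = 0")
      case True
      then have "point_cubic a b c 1 0 0 = 0 \<and> point_cubic_grad a b c 1 0 0 = (0, 0, 0)"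
        by (simp add: cub grd)
      with ell show False unfolding point_scheme_elliptic_def by (metis prod.inject zero_neq_one)
    next
      case False
      define w where "w = l / (3 * m)"
      have nz: "3 * m \<noteq> 0" using False three by simp
      then have l: "l = 3 * m * w" by (simp add: w_def)
      have "w ^ 3 = (3 * m) ^ 3 / (3 * m) ^ 3" by (simp only: w_def power_divide eq)
      also have "\<dots> = 1" by (rule divide_self) (use nz in \<open>rule power_not_zero\<close>)
      finally have w3: "w ^ 3 = 1" .
      define v where "v = w * w"
      have wv: "w * v = 1" using w3 by (simp only: v_def power3_eq_cube mult.assoc)
      have "v * v = w * (w * v)" by (simp only: v_def mult.assoc)
      then have vv: "v * v = w" by (simp only: wv mult_1_right)
      have v3: "v ^ 3 = 1" by (simp only: power3_eq_cube vv wv)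
      have lv: "l * v = 3 * m" by (simp only: l mult.assoc wv mult_1_right)
      have "point_cubic a b c 1 1 v = 0"
        by (simp add: cub lv v3)
      moreover have "point_cubic_grad a b c 1 1 v = (0, 0, 0)"
        by (simp add: grd lv power2_eq_square vv) (simp add: l)
      ultimately have "point_cubic a b c 1 1 v = 0 \<and> point_cubic_grad a b c 1 1 v = (0, 0, 0)" ..
      with ell show False unfolding point_scheme_elliptic_def by (metis prod.inject zero_neq_one)
    qed
  qed
  moreover have "point_scheme_elliptic a b c" if m: "m \<noteq> 0" and ne: "(3 * m) ^ 3 \<noteq> l ^ 3"
    unfolding point_scheme_elliptic_def
  proof (intro notI, elim exE conjE)
    fix x y z
    assume nz: "(x, y, z) \<noteq> (0, 0, 0)" and "point_cubic_grad a b c x y z = (0, 0, 0)"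
    then have e: "l * y * z = 3 * m * x ^ 2" "l * x * z = 3 * m * y ^ 2" "l * x * y = 3 * m * z ^ 2"
      by (simp_all add: grd)
    have "x \<noteq> 0 \<and> y \<noteq> 0 \<and> z \<noteq> 0"
      using nz e m three by (cases "x = 0"; cases "y = 0"; cases "z = 0") auto
    moreover have "(l * y * z) * (l * x * z) * (l * x * y)
        = (3 * m * x ^ 2) * (3 * m * y ^ 2) * (3 * m * z ^ 2)"
      by (simp only: e)
    then have "l ^ 3 * (x * y * z) ^ 2 = (3 * m) ^ 3 * (x * y * z) ^ 2"
      by (simp add: power2_eq_square power3_eq_cube algebra_simps)
    ultimately show False using ne by simp
  qed
  moreover have "3 * a * b * c = 3 * m" by (simp only: m_def mult.assoc)
  ultimately show ?thesis by (metis l_def m_def)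
qed

end

theory Submission
  imports Defs
begin

text \<open>
  Everything happens in degree two. The relations of \<open>S(a,b,c)\<close> are homogeneous of degree two, so a
  homogeneous element of degree two lies in the ideal they generate iff it lies in their linear span:
  a linear functional on the coefficients of the words of length two that kills the relations kills
  the whole ideal (\<open>pres_ideal_quadratic_functional\<close>). If \<open>c \<noteq> 0\<close> then the span is read off from
  the squares \<open>x\<^sup>2, y\<^sup>2, z\<^sup>2\<close>, one for each relation. For linear forms \<open>g, h\<close> with coefficient vectors \<open>p, s\<close>,
  the identity \<open>gh = q hg\<close> therefore says that \<open>M\<^sub>i\<^sub>j = p\<^sub>i s\<^sub>j - q s\<^sub>i p\<^sub>j\<close> satisfies
  \<open>c M\<^sub>2\<^sub>3 = a M\<^sub>1\<^sub>1\<close>, \<open>c M\<^sub>3\<^sub>2 = b M\<^sub>1\<^sub>1\<close> and their cyclic rotations (\<open>sklyanin_commutation_iff\<close>).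

  For the first part, \<open>q = 1\<close> makes the diagonal of \<open>M\<close> vanish, hence all of \<open>M\<close>, so \<open>p\<close> and \<open>s\<close> are
  proportional. If \<open>q\<^sup>2 \<noteq> 1\<close>, the equations for \<open>M\<^sub>2\<^sub>3\<close> and \<open>M\<^sub>3\<^sub>2\<close> can be solved for \<open>p\<^sub>2 s\<^sub>3\<close> and
  \<open>p\<^sub>3 s\<^sub>2\<close>: with \<open>e = c (1 + q)\<close>, \<open>u = a + q b\<close>, \<open>v = b + q a\<close> one gets \<open>e p\<^sub>2 s\<^sub>3 = u p\<^sub>1 s\<^sub>1\<close> and
  \<open>e p\<^sub>3 s\<^sub>2 = v p\<^sub>1 s\<^sub>1\<close>, cyclically. Multiplying around the cycle gives \<open>u\<^sup>3 = e\<^sup>3 = v\<^sup>3\<close>, and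
  \<open>u \<noteq> v\<close> by independence. So \<open>- (u + v) = - (1 + q)(a + b)\<close> is the third cube root of \<open>e\<^sup>3\<close>, that is,
  \<open>(a + b)\<^sup>3 = - c\<^sup>3\<close>. Then \<open>a\<^sup>3 + b\<^sup>3 + c\<^sup>3 = - 3ab(a + b)\<close> has the same cube as \<open>3abc\<close>, which
  contradicts smoothness of the point scheme. There remains \<open>q = -1\<close>, where \<open>M\<close> is symmetric, so
  \<open>a M\<^sub>i\<^sub>i = b M\<^sub>i\<^sub>i\<close>; if \<open>a \<noteq> b\<close> then \<open>M = 0\<close>, which says that the product of the commutative linear forms
  with coefficients \<open>p\<close> and \<open>s\<close> is zero, so one of them is zero.

  For the second part, with \<open>a = b = 1\<close> and \<open>q = -1\<close> the equations on \<open>(p, s)\<close> are exactly those of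
  \<open>\<Gamma>(S(-c,-c,2))\<close>. A nonzero solution with \<open>p\<close> proportional to \<open>s\<close> would force \<open>c\<^sup>3 = 1\<close>, which the
  Sklyanin condition excludes. So the anticommuting pairs up to scaling are the points of
  \<open>\<Gamma>(S(-c,-c,2))\<close>, and \<open>([0:1:-1], [-2:c:c])\<close> is one of them.
\<close>

section \<open>Arithmetic in presented algebras\<close>

lemma ring_free_ring: "ring (free_ring :: ('v, 'k::field) free_alg ring)"
  by (rule ringI, rule abelian_groupI, unfold ring_of_type_algebra_def)
    (auto simp: algebra_simps Group.monoid_def intro: exI[of _ "- _"] add.left_inverse)

lemma free_ring_simps:
  "carrier free_ring = (UNIV :: ('v, 'k::field) free_alg set)"
  "f \<otimes>\<^bsub>free_ring\<^esub> g = f * g" "f \<oplus>\<^bsub>free_ring\<^esub> g = f + g" "\<zero>\<^bsub>free_ring\<^esub> = (0 :: ('v, 'k) free_alg)"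
  by (simp_all add: ring_of_type_algebra_def)

lemma free_ring_uminus: "\<ominus>\<^bsub>free_ring\<^esub> f = - (f :: ('v, 'k::field) free_alg)"
proof -
  interpret ring "free_ring :: ('v, 'k) free_alg ring" by (rule ring_free_ring)
  show ?thesis by (rule minus_equality) (simp_all add: free_ring_simps)
qed

lemma ideal_pres: "ideal (Idl\<^bsub>free_ring\<^esub> R) (free_ring :: ('v, 'k::field) free_alg ring)"
  by (rule ring.genideal_ideal[OF ring_free_ring]) (simp add: free_ring_simps)

lemma ring_pres_alg: "ring (pres_alg R)"
  unfolding pres_alg_def by (rule ideal.quotient_is_ring[OF ideal_pres])

lemma pres_class_ring_hom: "ring_hom_ring free_ring (pres_alg R) (pres_class R)"
  using ideal.rcos_ring_hom_ring[OF ideal_pres] unfolding pres_alg_def pres_class_def[abs_def] .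

lemma pres_class_carrier: "pres_class R f \<in> carrier (pres_alg R)"
  using ring_hom_closed[OF ring_hom_ring.homh[OF pres_class_ring_hom]] by (simp add: free_ring_simps)

lemma pres_class_mult: "pres_class R f \<otimes>\<^bsub>pres_alg R\<^esub> pres_class R g = pres_class R (f * g)"
  using ring_hom_mult[OF ring_hom_ring.homh[OF pres_class_ring_hom], of f g]
  by (simp add: free_ring_simps)

lemma pres_class_add: "pres_class R f \<oplus>\<^bsub>pres_alg R\<^esub> pres_class R g = pres_class R (f + g)"
  using ring_hom_add[OF ring_hom_ring.homh[OF pres_class_ring_hom], of f g]
  by (simp add: free_ring_simps)

lemma pres_class_zero: "\<zero>\<^bsub>pres_alg R\<^esub> = pres_class R 0"
  using ring_hom_zero[OF ring_hom_ring.homh[OF pres_class_ring_hom[of R]] ring_free_ring ring_pres_alg]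
  by (simp add: free_ring_simps)

lemma pres_class_uminus: "\<ominus>\<^bsub>pres_alg R\<^esub> pres_class R f = pres_class R (- f)"
proof -
  interpret ring "pres_alg R" by (rule ring_pres_alg)
  show ?thesis
    by (rule minus_equality) (simp_all add: pres_class_carrier pres_class_add pres_class_zero)
qed

lemma pres_class_eq_iff: "pres_class R f = pres_class R g \<longleftrightarrow> f - g \<in> Idl\<^bsub>free_ring\<^esub> R"
  using ring.quotient_eq_iff_same_a_r_cos[OF ring_free_ring ideal_pres, of f g R]
  by (simp add: pres_class_def free_ring_simps a_minus_def free_ring_uminus)

section \<open>The part of the ideal of relations in degree at most two\<close>

text \<open>
  The convolution product runs over all factorisations of a word, and a word factors only into a prefix
  and the complementary suffix.
\<close>

lemma lookup_times_word:
  fixes f g :: "('v, 'k::field) free_alg"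
  shows "Poly_Mapping.lookup (f * g) (NC_Word w) =
    (\<Sum>i\<le>length w. Poly_Mapping.lookup f (NC_Word (take i w)) * Poly_Mapping.lookup g (NC_Word (drop i w)))"
proof -
  \<comment> \<open>\<open>h l\<close> collects the coefficients of \<open>g\<close> at the words that complete \<open>l\<close> to \<open>w\<close>\<close>
  define h where "h l = (\<Sum>q. Poly_Mapping.lookup g q when NC_Word w = l + q)" for l
  have h: "h (NC_Word u) = (if \<exists>v. w = u @ v then Poly_Mapping.lookup g (NC_Word (drop (length u) w)) else 0)"
    for u
  proof (cases "\<exists>v. w = u @ v")
    case True
    then have eq: "(\<lambda>q. Poly_Mapping.lookup g q when NC_Word w = NC_Word u + q) =
      (\<lambda>q. Poly_Mapping.lookup g q when q = NC_Word (drop (length u) w))"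
      by (intro ext, case_tac q) (auto simp: when_def plus_nc_word_def)
    show ?thesis unfolding h_def eq using True by simp
  next
    case False
    then have "NC_Word w \<noteq> NC_Word u + q" for q by (auto simp: plus_nc_word_def)
    with False show ?thesis by (simp add: h_def)
  qed
  have "Poly_Mapping.lookup (f * g) (NC_Word w) = (\<Sum>l. Poly_Mapping.lookup f l * h l)"
    by (simp add: lookup_mult h_def)
  also have "\<dots> = (\<Sum>l\<in>(\<lambda>i. NC_Word (take i w)) ` {..length w}. Poly_Mapping.lookup f l * h l)"
  proof (rule Sum_any.expand_superset)
    show "{l. Poly_Mapping.lookup f l * h l \<noteq> 0} \<subseteq> (\<lambda>i. NC_Word (take i w)) ` {..length w}"
    proof
      fix l assume "l \<in> {l. Poly_Mapping.lookup f l * h l \<noteq> 0}"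
      then obtain u v where "l = NC_Word u" "w = u @ v"
        by (cases l) (auto simp: h split: if_splits)
      then show "l \<in> (\<lambda>i. NC_Word (take i w)) ` {..length w}"
        by (intro image_eqI[of _ _ "length u"]) auto
    qed
  qed simp
  also have "\<dots> = (\<Sum>i\<le>length w. Poly_Mapping.lookup f (NC_Word (take i w)) * h (NC_Word (take i w)))"
    by (subst sum.reindex) (auto simp: inj_on_def dest: arg_cong[of _ _ length])
  also have "\<dots> = (\<Sum>i\<le>length w. Poly_Mapping.lookup f (NC_Word (take i w)) *
      Poly_Mapping.lookup g (NC_Word (drop i w)))"
  proof (rule sum.cong[OF refl])
    fix i assume "i \<in> {..length w}"
    moreover have "\<exists>v. w = take i w @ v" by (metis append_take_drop_id)
    ultimately show "Poly_Mapping.lookup f (NC_Word (take i w)) * h (NC_Word (take i w)) =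
      Poly_Mapping.lookup f (NC_Word (take i w)) * Poly_Mapping.lookup g (NC_Word (drop i w))"
      by (simp add: h min_def)
  qed
  finally show ?thesis .
qed

text \<open>
  The elements that have no terms in degrees \<open>0\<close> and \<open>1\<close> and whose degree-two part is killed by the
  functional \<open>C\<close> form an ideal, which contains the relations: on words of length at most two, multiplication by \<open>h\<close> on either side
  acts on them as multiplication by the constant term of \<open>h\<close>.
\<close>

lemma pres_ideal_quadratic:
  fixes R :: "('v::finite, 'k::field) free_alg set"
  assumes hom: "\<And>f. f \<in> R \<Longrightarrow> homogeneous 2 f"
    and van: "\<And>f. f \<in> R \<Longrightarrow> (\<Sum>i\<in>UNIV. \<Sum>j\<in>UNIV. C i j * Poly_Mapping.lookup f (NC_Word [i, j])) = 0"
    and f: "f \<in> Idl\<^bsub>free_ring\<^esub> R"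
  shows "(\<forall>w. length w < 2 \<longrightarrow> Poly_Mapping.lookup f (NC_Word w) = 0) \<and>
    (\<Sum>i\<in>UNIV. \<Sum>j\<in>UNIV. C i j * Poly_Mapping.lookup f (NC_Word [i, j])) = 0"
proof -
  define L where "L g = (\<Sum>i\<in>UNIV. \<Sum>j\<in>UNIV. C i j * Poly_Mapping.lookup g (NC_Word [i, j]))"
    for g :: "('v, 'k) free_alg"
  define J where "J = {g. (\<forall>w. length w < 2 \<longrightarrow> Poly_Mapping.lookup g (NC_Word w) = 0) \<and> L g = 0}"
  interpret F: ring "free_ring :: ('v, 'k) free_alg ring" by (rule ring_free_ring)
  have left: "Poly_Mapping.lookup (h * g) (NC_Word w) =
      Poly_Mapping.lookup h (NC_Word []) * Poly_Mapping.lookup g (NC_Word w)"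
    if g: "g \<in> J" and w: "length w \<le> 2" for g h w
  proof -
    have "Poly_Mapping.lookup (h * g) (NC_Word w) = (\<Sum>i\<in>{0}. Poly_Mapping.lookup h (NC_Word (take i w)) *
        Poly_Mapping.lookup g (NC_Word (drop i w)))"
      unfolding lookup_times_word using g w
      by (intro sum.mono_neutral_right) (auto simp: J_def)
    then show ?thesis by simp
  qed
  have right: "Poly_Mapping.lookup (g * h) (NC_Word w) =
      Poly_Mapping.lookup h (NC_Word []) * Poly_Mapping.lookup g (NC_Word w)"
    if g: "g \<in> J" and w: "length w \<le> 2" for g h w
  proof -
    have "Poly_Mapping.lookup (g * h) (NC_Word w) = (\<Sum>i\<in>{length w}. Poly_Mapping.lookup g (NC_Word (take i w)) *
        Poly_Mapping.lookup h (NC_Word (drop i w)))"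
      unfolding lookup_times_word using g w
      by (intro sum.mono_neutral_right) (auto simp: J_def)
    then show ?thesis by simp
  qed
  have L_mult: "L g' = k * L g" if "\<And>i j. Poly_Mapping.lookup g' (NC_Word [i, j]) = k * Poly_Mapping.lookup g (NC_Word [i, j])"
    for g' g k
    unfolding L_def that by (simp add: sum_distrib_left mult.left_commute)
  have "ideal J free_ring"
  proof (rule idealI)
    show "subgroup J (add_monoid free_ring)"
    proof
      fix g assume "g \<in> J"
      then show "inv\<^bsub>add_monoid free_ring\<^esub> g \<in> J"
        using free_ring_uminus[of g] by (simp add: a_inv_def J_def L_def sum_negf)
    qed (auto simp: free_ring_simps J_def L_def lookup_add distrib_left sum.distrib)
  next
    fix g h assume "g \<in> J"
    then show "h \<otimes>\<^bsub>free_ring\<^esub> g \<in> J" "g \<otimes>\<^bsub>free_ring\<^esub> h \<in> J"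
      using left[of g] right[of g] L_mult[of "h * g" "Poly_Mapping.lookup h (NC_Word [])" g]
        L_mult[of "g * h" "Poly_Mapping.lookup h (NC_Word [])" g]
      by (auto simp: free_ring_simps J_def)
  qed (rule ring_free_ring)
  moreover have "R \<subseteq> J"
  proof
    fix g assume g: "g \<in> R"
    have "Poly_Mapping.lookup g (NC_Word w) = 0" if "length w < 2" for w
      using hom[OF g] that by (force simp: homogeneous_def in_keys_iff)
    with van[OF g] show "g \<in> J" by (simp add: J_def L_def)
  qed
  ultimately have "Idl\<^bsub>free_ring\<^esub> R \<subseteq> J" by (rule F.genideal_minimal)
  with f have "f \<in> J" by blast
  then show ?thesis
    by (simp add: J_def L_def)
qed

lemma pres_ideal_quadratic_functional:
  fixes R :: "('v::finite, 'k::field) free_alg set"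
  assumes "\<And>f. f \<in> R \<Longrightarrow> homogeneous 2 f"
    and "\<And>f. f \<in> R \<Longrightarrow> (\<Sum>i\<in>UNIV. \<Sum>j\<in>UNIV. C i j * Poly_Mapping.lookup f (NC_Word [i, j])) = 0"
    and "f \<in> Idl\<^bsub>free_ring\<^esub> R"
  shows "(\<Sum>i\<in>UNIV. \<Sum>j\<in>UNIV. C i j * Poly_Mapping.lookup f (NC_Word [i, j])) = 0"
  using pres_ideal_quadratic[OF assms] by blast

lemma pres_ideal_low_degree:
  fixes R :: "('v::finite, 'k::field) free_alg set"
  assumes "\<And>f. f \<in> R \<Longrightarrow> homogeneous 2 f" and "f \<in> Idl\<^bsub>free_ring\<^esub> R" and "length w < 2"
  shows "Poly_Mapping.lookup f (NC_Word w) = 0"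
  using pres_ideal_quadratic[of R "\<lambda>_ _. 0" f] assms by simp

section \<open>Linear forms\<close>

definition linear_form :: "'k ^ 'v \<Rightarrow> ('v::finite, 'k::field) free_alg"
  where "linear_form p = (\<Sum>i\<in>UNIV. fconst (p $ i) * fvar i)"

lemma pres_linform_eq: "pres_linform R p = pres_class R (linear_form p)"
  by (simp add: pres_linform_def linear_form_def)

lemma lookup_fconst_times: "Poly_Mapping.lookup (fconst k * f) w = k * Poly_Mapping.lookup f w"
proof (cases w)
  case (NC_Word u)
  have "Poly_Mapping.lookup (fconst k * f) (NC_Word u) =
    (\<Sum>i\<in>{0}. Poly_Mapping.lookup (fconst k) (NC_Word (take i u)) * Poly_Mapping.lookup f (NC_Word (drop i u)))"
    unfolding lookup_times_word
    by (rule sum.mono_neutral_right) (auto simp: fconst_def lookup_single zero_nc_word_def when_def)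
  then show ?thesis by (simp add: NC_Word fconst_def lookup_single zero_nc_word_def)
qed

lemma lookup_linear_form:
  "Poly_Mapping.lookup (linear_form p) (NC_Word w) = (if length w = 1 then p $ hd w else 0)"
proof -
  have "Poly_Mapping.lookup (linear_form p) (NC_Word w) = (\<Sum>i\<in>UNIV. p $ i * (if w = [i] then 1 else 0))"
    by (simp add: linear_form_def lookup_sum lookup_fconst_times fvar_def lookup_single when_def eq_commute)
  also have "\<dots> = (\<Sum>i\<in>UNIV. if i = hd w then (if length w = 1 then p $ hd w else 0) else 0)"
    by (rule sum.cong) (auto simp: length_Suc_conv)
  finally show ?thesis by simp
qed

lemma linear_form_scale: "fconst k * linear_form p = linear_form (k *s p)"
proof (rule poly_mapping_eqI)
  fix w
  show "Poly_Mapping.lookup (fconst k * linear_form p) w = Poly_Mapping.lookup (linear_form (k *s p)) w"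
    by (cases w) (simp add: lookup_fconst_times lookup_linear_form)
qed

lemma homogeneous_one_linear_form:
  "homogeneous 1 f \<longleftrightarrow> (\<exists>p. f = linear_form p)"
proof
  assume f: "homogeneous 1 f"
  have "f = linear_form (\<chi> i. Poly_Mapping.lookup f (NC_Word [i]))"
  proof (rule poly_mapping_eqI)
    fix w
    show "Poly_Mapping.lookup f w =
      Poly_Mapping.lookup (linear_form (\<chi> i. Poly_Mapping.lookup f (NC_Word [i]))) w"
    proof (cases w)
      case (NC_Word u)
      show ?thesis
      proof (cases "length u = 1")
        case True
        then obtain i where "u = [i]" by (auto simp: length_Suc_conv)
        then show ?thesis by (simp add: NC_Word lookup_linear_form)
      next
        case False
        with f have "Poly_Mapping.lookup f w = 0"
          by (force simp: NC_Word homogeneous_def in_keys_iff)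
        with False show ?thesis by (simp add: NC_Word lookup_linear_form)
      qed
    qed
  qed
  then show "\<exists>p. f = linear_form p" ..
next
  assume "\<exists>p. f = linear_form p"
  then obtain p where p: "f = linear_form p" by blast
  show "homogeneous 1 f"
    unfolding homogeneous_def
  proof
    fix w assume "w \<in> Poly_Mapping.keys f"
    then show "length (letters w) = 1"
      by (cases w) (simp add: p in_keys_iff lookup_linear_form split: if_splits)
  qed
qed

lemma lookup_linear_form_times:
  "Poly_Mapping.lookup (linear_form p * linear_form q) (NC_Word w) =
    (if length w = 2 then p $ (w ! 0) * q $ (w ! 1) else 0)"
proof (cases "length w = 2")
  case True
  then obtain i j where "w = [i, j]" by (auto simp: length_Suc_conv numeral_2_eq_2)
  then show ?thesis
    unfolding lookup_times_word lookup_linear_form by (simp add: numeral_2_eq_2)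
next
  case False
  then show ?thesis
    unfolding lookup_times_word lookup_linear_form by (auto intro!: sum.neutral)
qed

text \<open>
  Quadratic relations leave degree one untouched, so the linear forms of the presented algebra are
  faithfully given by their coefficient vectors.
\<close>

lemma pres_linform_eq_iff:
  fixes R :: "('v::finite, 'k::field) free_alg set"
  assumes "\<And>f. f \<in> R \<Longrightarrow> homogeneous 2 f"
  shows "pres_linform R p = pres_linform R q \<longleftrightarrow> p = q"
proof
  assume "pres_linform R p = pres_linform R q"
  then have "linear_form p - linear_form q \<in> Idl\<^bsub>free_ring\<^esub> R"
    by (simp add: pres_linform_eq pres_class_eq_iff)
  from pres_ideal_low_degree[OF assms this, of "[_]"]
  have "p $ i = q $ i" for i by (simp add: lookup_minus lookup_linear_form)
  then show "p = q" by (simp add: vec_eq_iff)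
qed simp

lemma pres_degree_one: "pres_degree R 1 = range (pres_linform (R :: ('a::finite, 'b::field) free_alg set))"
proof -
  have "{f. homogeneous 1 f} = range (linear_form :: 'b ^ 'a \<Rightarrow> _)"
    by (auto simp: homogeneous_one_linear_form simp del: One_nat_def)
  then show ?thesis
    by (simp add: pres_degree_def image_image pres_linform_eq[abs_def] del: One_nat_def)
qed

lemma pres_scalar_linform:
  "pres_scalar R k \<otimes>\<^bsub>pres_alg R\<^esub> pres_linform R p = pres_linform R (k *s p)"
  by (simp add: pres_scalar_def pres_linform_eq pres_class_mult linear_form_scale)

lemma pres_linform_zero: "pres_linform R 0 = \<zero>\<^bsub>pres_alg R\<^esub>"
  by (simp add: pres_linform_eq linear_form_def pres_class_zero fconst_def)

lemma pres_independent_linforms: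
  fixes R :: "('v::finite, 'k::field) free_alg set"
  assumes "\<And>f. f \<in> R \<Longrightarrow> homogeneous 2 f"
  shows "pres_independent R [pres_linform R p, pres_linform R q] \<longleftrightarrow> q \<noteq> 0 \<and> (\<forall>k. p \<noteq> k *s q)"
proof -
  interpret ring "pres_alg R" by (rule ring_pres_alg)
  have carr: "pres_linform R v \<in> carrier (pres_alg R)" for v
    by (simp add: pres_linform_eq pres_class_carrier)
  have "independent (range (pres_scalar R)) [pres_linform R p, pres_linform R q] \<longleftrightarrow>
      pres_linform R q \<noteq> \<zero>\<^bsub>pres_alg R\<^esub> \<and> pres_linform R p \<notin> Span (range (pres_scalar R)) [pres_linform R q]"
    using independent_backwards(1)[of "range (pres_scalar R)" "pres_linform R p" "[pres_linform R q]"]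
      independent_backwards(2)[of "range (pres_scalar R)" "pres_linform R p" "[pres_linform R q]"]
      independent_backwards(1)[of "range (pres_scalar R)" "pres_linform R q" "[]"]
    by (auto simp: carr intro!: li_Cons simp del: Span.simps) auto
  moreover have "pres_linform R p \<in> Span (range (pres_scalar R)) [pres_linform R q] \<longleftrightarrow> (\<exists>k. p = k *s q)"
    by (simp add: line_extension_mem_iff pres_scalar_linform carr pres_linform_eq_iff[OF assms])
  ultimately show ?thesis
    unfolding pres_independent_def
    by (simp add: pres_linform_eq_iff[OF assms] flip: pres_linform_zero)
qed

lemma pres_linform_commutation:
  "pres_linform R p \<otimes>\<^bsub>pres_alg R\<^esub> pres_linform R q =
     pres_scalar R t \<otimes>\<^bsub>pres_alg R\<^esub> (pres_linform R q \<otimes>\<^bsub>pres_alg R\<^esub> pres_linform R p) \<longleftrightarrow>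
   linear_form p * linear_form q - fconst t * (linear_form q * linear_form p) \<in> Idl\<^bsub>free_ring\<^esub> R"
  by (simp add: pres_linform_eq pres_scalar_def pres_class_mult pres_class_eq_iff)

lemma pres_uminus_eq_scalar:
  "\<ominus>\<^bsub>pres_alg R\<^esub> (pres_class R f) = pres_scalar R (- 1) \<otimes>\<^bsub>pres_alg R\<^esub> pres_class R f"
proof -
  have "fconst (- 1) * f = - f" by (rule poly_mapping_eqI) (simp add: lookup_fconst_times)
  then show ?thesis by (simp add: pres_scalar_def pres_class_mult pres_class_uminus)
qed

section \<open>Commutation up to a scalar in Sklyanin algebras\<close>

lemma sklyanin_rels_eq:
  "sklyanin_rels a b c =
    {Poly_Mapping.single (NC_Word [2, 3]) a + Poly_Mapping.single (NC_Word [3, 2]) b + Poly_Mapping.single (NC_Word [1, 1]) c,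
     Poly_Mapping.single (NC_Word [3, 1]) a + Poly_Mapping.single (NC_Word [1, 3]) b + Poly_Mapping.single (NC_Word [2, 2]) c,
     Poly_Mapping.single (NC_Word [1, 2]) a + Poly_Mapping.single (NC_Word [2, 1]) b + Poly_Mapping.single (NC_Word [3, 3]) c}"
  by (simp add: sklyanin_rels_def Let_def fconst_def fvar_def power2_eq_square mult_single
      plus_nc_word_def zero_nc_word_def)

lemma homogeneous_sklyanin_rels:
  assumes f: "f \<in> sklyanin_rels a b c"
  shows "homogeneous 2 f"
  unfolding homogeneous_def
proof (intro ballI, rule ccontr)
  fix w assume w: "w \<in> Poly_Mapping.keys f" and "length (letters w) \<noteq> 2"
  then have "NC_Word [i, j] \<noteq> w" for i j by auto
  then have "Poly_Mapping.lookup f w = 0"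
    using f unfolding sklyanin_rels_eq insert_iff empty_iff
    by (elim disjE) (simp_all add: lookup_add lookup_single)
  with w show False by (simp add: in_keys_iff)
qed

lemma multilinearization_sklyanin_rels:
  "(\<forall>f\<in>sklyanin_rels a b c. multilinearization f p q = 0) \<longleftrightarrow>
    a * p $ 2 * q $ 3 + b * p $ 3 * q $ 2 + c * p $ 1 * q $ 1 = 0 \<and>
    a * p $ 3 * q $ 1 + b * p $ 1 * q $ 3 + c * p $ 2 * q $ 2 = 0 \<and>
    a * p $ 1 * q $ 2 + b * p $ 2 * q $ 1 + c * p $ 3 * q $ 3 = 0"
  by (simp add: sklyanin_rels_eq multilinearization_def lookup_add lookup_single sum_3 add_ac)

text \<open>
  Each relation contains the square of one variable, with coefficient \<open>c\<close>, and the squares of the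
  other two do not occur in it. The diagonal coefficients of \<open>f\<close>, divided by \<open>c\<close>, are therefore the only
  possible multipliers of the relations, and the six equations say that these multipliers also produce the
  off-diagonal coefficients.
\<close>

lemma sklyanin_ideal_degree_two:
  fixes a b c :: "'k::field"
  assumes c: "c \<noteq> 0" and f: "homogeneous 2 f"
  defines "M \<equiv> \<lambda>i j. Poly_Mapping.lookup f (NC_Word [i, j])"
  shows "f \<in> Idl\<^bsub>free_ring\<^esub> (sklyanin_rels a b c) \<longleftrightarrow>
    c * M 2 3 = a * M 1 1 \<and> c * M 3 2 = b * M 1 1 \<and>
    c * M 3 1 = a * M 2 2 \<and> c * M 1 3 = b * M 2 2 \<and>
    c * M 1 2 = a * M 3 3 \<and> c * M 2 1 = b * M 3 3"
    (is "?L \<longleftrightarrow> ?R")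
proof
  assume L: ?L
  have vanish: "(\<Sum>i\<in>UNIV. \<Sum>j\<in>UNIV. C i j * M i j) = 0"
    if "\<forall>g\<in>sklyanin_rels a b c.
      (\<Sum>i\<in>UNIV. \<Sum>j\<in>UNIV. C i j * Poly_Mapping.lookup g (NC_Word [i, j])) = 0" for C
    unfolding M_def
    by (rule pres_ideal_quadratic_functional[OF homogeneous_sklyanin_rels bspec[OF that] L])
  have "c * M 2 3 - a * M 1 1 = 0"
    using vanish[of "\<lambda>i j. if i = 2 \<and> j = 3 then c else if i = 1 \<and> j = 1 then - a else 0"]
    by (simp add: sklyanin_rels_eq lookup_add lookup_single sum_3)
  moreover have "c * M 3 2 - b * M 1 1 = 0"
    using vanish[of "\<lambda>i j. if i = 3 \<and> j = 2 then c else if i = 1 \<and> j = 1 then - b else 0"]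
    by (simp add: sklyanin_rels_eq lookup_add lookup_single sum_3)
  moreover have "c * M 3 1 - a * M 2 2 = 0"
    using vanish[of "\<lambda>i j. if i = 3 \<and> j = 1 then c else if i = 2 \<and> j = 2 then - a else 0"]
    by (simp add: sklyanin_rels_eq lookup_add lookup_single sum_3)
  moreover have "c * M 1 3 - b * M 2 2 = 0"
    using vanish[of "\<lambda>i j. if i = 1 \<and> j = 3 then c else if i = 2 \<and> j = 2 then - b else 0"]
    by (simp add: sklyanin_rels_eq lookup_add lookup_single sum_3)
  moreover have "c * M 1 2 - a * M 3 3 = 0"
    using vanish[of "\<lambda>i j. if i = 1 \<and> j = 2 then c else if i = 3 \<and> j = 3 then - a else 0"]
    by (simp add: sklyanin_rels_eq lookup_add lookup_single sum_3)
  moreover have "c * M 2 1 - b * M 3 3 = 0"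
    using vanish[of "\<lambda>i j. if i = 2 \<and> j = 1 then c else if i = 3 \<and> j = 3 then - b else 0"]
    by (simp add: sklyanin_rels_eq lookup_add lookup_single sum_3)
  ultimately show ?R by simp
next
  assume R: ?R
  interpret I: ideal "Idl\<^bsub>free_ring\<^esub> (sklyanin_rels a b c)" "free_ring :: (3, 'k) free_alg ring"
    by (rule ideal_pres)
  have M: "Poly_Mapping.lookup f (NC_Word [i, j]) = M i j" for i j
    by (simp add: M_def)
  have in_ideal: "fconst k * g \<in> Idl\<^bsub>free_ring\<^esub> (sklyanin_rels a b c)" if "g \<in> sklyanin_rels a b c" for k g
    using I.I_l_closed[of g "fconst k"] that ring.genideal_self[OF ring_free_ring, of "sklyanin_rels a b c"]
    by (auto simp: free_ring_simps)
  have add: "g + h \<in> Idl\<^bsub>free_ring\<^esub> (sklyanin_rels a b c)"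
    if "g \<in> Idl\<^bsub>free_ring\<^esub> (sklyanin_rels a b c)" "h \<in> Idl\<^bsub>free_ring\<^esub> (sklyanin_rels a b c)" for g h
    using additive_subgroup.a_closed[OF ideal.axioms(1)[OF ideal_pres] that] by (simp add: free_ring_simps)
  have coeffs: "M 2 3 = M 1 1 / c * a" "M 3 2 = M 1 1 / c * b" "M 3 1 = M 2 2 / c * a"
      "M 1 3 = M 2 2 / c * b" "M 1 2 = M 3 3 / c * a" "M 2 1 = M 3 3 / c * b"
    using R c by (simp_all add: field_simps)
  have "f = fconst (M 1 1 / c) * (Poly_Mapping.single (NC_Word [2, 3]) a +
        Poly_Mapping.single (NC_Word [3, 2]) b + Poly_Mapping.single (NC_Word [1, 1]) c) +
      fconst (M 2 2 / c) * (Poly_Mapping.single (NC_Word [3, 1]) a +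
        Poly_Mapping.single (NC_Word [1, 3]) b + Poly_Mapping.single (NC_Word [2, 2]) c) +
      fconst (M 3 3 / c) * (Poly_Mapping.single (NC_Word [1, 2]) a +
        Poly_Mapping.single (NC_Word [2, 1]) b + Poly_Mapping.single (NC_Word [3, 3]) c)" (is "f = ?g")
  proof (rule poly_mapping_eqI)
    fix w :: "3 nc_word"
    show "Poly_Mapping.lookup f w = Poly_Mapping.lookup ?g w"
    proof (cases "\<exists>i j. w = NC_Word [i, j]")
      case True
      then obtain i j where w: "w = NC_Word [i, j]" by blast
      show ?thesis
        using coeffs c exhaust_3[of i] exhaust_3[of j] M
        by (elim disjE) (simp_all add: w lookup_fconst_times lookup_add lookup_single)
    next
      case False
      then have "length (letters w) \<noteq> 2"
        by (cases w) (auto simp: length_Suc_conv numeral_2_eq_2)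
      with f have "Poly_Mapping.lookup f w = 0" by (auto simp: homogeneous_def in_keys_iff)
      moreover from False have "NC_Word [i, j] \<noteq> w" for i j by auto
      then have "Poly_Mapping.lookup ?g w = 0"
        by (simp add: lookup_fconst_times lookup_add lookup_single)
      ultimately show ?thesis by simp
    qed
  qed
  also have "?g \<in> Idl\<^bsub>free_ring\<^esub> (sklyanin_rels a b c)"
    by (intro add in_ideal) (simp_all add: sklyanin_rels_eq)
  finally show ?L .
qed

lemma sklyanin_commutation_iff:
  fixes a b c q :: "'k::field" and p s :: "'k ^ 3"
  assumes c: "c \<noteq> 0"
  defines "R \<equiv> sklyanin_rels a b c" and "M \<equiv> \<lambda>i j. p $ i * s $ j - q * (s $ i * p $ j)"
  shows "pres_linform R p \<otimes>\<^bsub>pres_alg R\<^esub> pres_linform R s =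
      pres_scalar R q \<otimes>\<^bsub>pres_alg R\<^esub> (pres_linform R s \<otimes>\<^bsub>pres_alg R\<^esub> pres_linform R p) \<longleftrightarrow>
    c * M 2 3 = a * M 1 1 \<and> c * M 3 2 = b * M 1 1 \<and>
    c * M 3 1 = a * M 2 2 \<and> c * M 1 3 = b * M 2 2 \<and>
    c * M 1 2 = a * M 3 3 \<and> c * M 2 1 = b * M 3 3"
proof -
  define f where "f = linear_form p * linear_form s - fconst q * (linear_form s * linear_form p)"
  have look: "Poly_Mapping.lookup f (NC_Word w) =
      (if length w = 2 then p $ (w ! 0) * s $ (w ! 1) - q * (s $ (w ! 0) * p $ (w ! 1)) else 0)" for w
    by (simp add: f_def lookup_minus lookup_fconst_times lookup_linear_form_times)
  have "length (letters w) = 2" if "w \<in> Poly_Mapping.keys f" for w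
    using that by (cases w) (simp add: in_keys_iff look split: if_splits)
  then have "homogeneous 2 f" by (simp add: homogeneous_def)
  have coeff: "Poly_Mapping.lookup f (NC_Word [i, j]) = p $ i * s $ j - q * (s $ i * p $ j)" for i j
    by (simp add: look)
  from sklyanin_ideal_degree_two[OF c \<open>homogeneous 2 f\<close>, of a b] show ?thesis
    unfolding R_def M_def pres_linform_commutation f_def[symmetric] coeff .
qed

text \<open>
  The coefficient equations only involve products \<open>p\<^sub>i s\<^sub>j\<close>, so they can say something about
  independence only in terms of the two-by-two minors.
\<close>

lemma vanishing_minors_proportional:
  fixes p s :: "'k::field ^ 3"
  assumes "s \<noteq> 0" and "p $ 2 * s $ 3 = p $ 3 * s $ 2" "p $ 3 * s $ 1 = p $ 1 * s $ 3"
    "p $ 1 * s $ 2 = p $ 2 * s $ 1"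
  shows "\<exists>k. p = k *s s"
proof -
  from assms(1) obtain i where i: "s $ i \<noteq> 0" by (auto simp: vec_eq_iff)
  have minors: "p $ j * s $ i = p $ i * s $ j" for j
    using assms(2-4) exhaust_3[of i] exhaust_3[of j] by auto
  have "p $ j = p $ i / s $ i * s $ j" for j
    using i minors[of j] by (simp add: field_simps)
  then have "p = (p $ i / s $ i) *s s"
    unfolding vec_eq_iff vector_smult_component by blast
  then show ?thesis ..
qed

section \<open>The coefficient equations over a field\<close>

text \<open>
  If some product \<open>p\<^sub>i s\<^sub>i\<close> vanished, then the equations would make the vectors proportional.
  Since all three are nonzero, the product of the three equations for \<open>u\<close> can be divided by
  \<open>p\<^sub>1 s\<^sub>1 p\<^sub>2 s\<^sub>2 p\<^sub>3 s\<^sub>3\<close>, because each coordinate occurs once on either side; likewise for \<open>v\<close>.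
\<close>

lemma twisted_products_cube_roots:
  fixes e u v :: "'k::field"
  assumes e: "e \<noteq> 0"
    and u: "e * (p2 * s3) = u * (p1 * s1)" "e * (p3 * s1) = u * (p2 * s2)" "e * (p1 * s2) = u * (p3 * s3)"
    and v: "e * (p3 * s2) = v * (p1 * s1)" "e * (p1 * s3) = v * (p2 * s2)" "e * (p2 * s1) = v * (p3 * s3)"
    and indep: "\<not> (p2 * s3 = p3 * s2 \<and> p3 * s1 = p1 * s3 \<and> p1 * s2 = p2 * s1)"
  shows "u ^ 3 = e ^ 3" and "v ^ 3 = e ^ 3" and "u \<noteq> v"
proof -
  show "u \<noteq> v"
  proof
    assume "u = v"
    with u v have "e * (p2 * s3) = e * (p3 * s2)" "e * (p3 * s1) = e * (p1 * s3)" "e * (p1 * s2) = e * (p2 * s1)"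
      by simp_all
    with e indep show False by simp
  qed
  have "p1 \<noteq> 0 \<and> s1 \<noteq> 0"
    using u v indep e by (cases "p1 = 0"; cases "s1 = 0"; cases "p2 = 0"; cases "s2 = 0") auto
  moreover have "p2 \<noteq> 0 \<and> s2 \<noteq> 0"
    using u v indep e by (cases "p2 = 0"; cases "s2 = 0"; cases "p3 = 0"; cases "s3 = 0") auto
  moreover have "p3 \<noteq> 0 \<and> s3 \<noteq> 0"
    using u v indep e by (cases "p3 = 0"; cases "s3 = 0"; cases "p1 = 0"; cases "s1 = 0") auto
  ultimately have P: "(p1 * s1) * (p2 * s2) * (p3 * s3) \<noteq> 0" by simp
  have "(e * (p2 * s3)) * (e * (p3 * s1)) * (e * (p1 * s2)) = (u * (p1 * s1)) * (u * (p2 * s2)) * (u * (p3 * s3))"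
    by (simp only: u)
  then have "e ^ 3 * ((p1 * s1) * (p2 * s2) * (p3 * s3)) = u ^ 3 * ((p1 * s1) * (p2 * s2) * (p3 * s3))"
    by (simp add: power3_eq_cube mult_ac)
  with P show "u ^ 3 = e ^ 3" by simp
  have "(e * (p3 * s2)) * (e * (p1 * s3)) * (e * (p2 * s1)) = (v * (p1 * s1)) * (v * (p2 * s2)) * (v * (p3 * s3))"
    by (simp only: v)
  then have "e ^ 3 * ((p1 * s1) * (p2 * s2) * (p3 * s3)) = v ^ 3 * ((p1 * s1) * (p2 * s2) * (p3 * s3))"
    by (simp add: power3_eq_cube mult_ac)
  with P show "v ^ 3 = e ^ 3" by simp
qed

text \<open>
  From \<open>u\<^sup>3 = v\<^sup>3\<close> and \<open>u \<noteq> v\<close> follows \<open>u\<^sup>2 + u v + v\<^sup>2 = 0\<close>, which makes \<open>- (u + v)\<close> the third cube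
  root of \<open>e\<^sup>3\<close>.
\<close>

lemma distinct_cube_roots_sum:
  fixes e u v :: "'k::field"
  assumes "u ^ 3 = e ^ 3" "v ^ 3 = e ^ 3" "u \<noteq> v"
  shows "(u + v) ^ 3 = - (e ^ 3)"
proof -
  have "(u - v) * (u ^ 2 + u * v + v ^ 2) = u ^ 3 - v ^ 3" by (simp add: power2_eq_square power3_eq_cube algebra_simps)
  with assms have s: "u ^ 2 + u * v + v ^ 2 = 0" by simp
  have "(u + v) ^ 3 = (u + 2 * v) * (u ^ 2 + u * v + v ^ 2) - v ^ 3"
    by (simp add: power2_eq_square power3_eq_cube algebra_simps)
  with s assms show ?thesis by simp
qed

text \<open>
  Each pair of equations is a linear system for two products \<open>p\<^sub>i s\<^sub>j\<close> and \<open>p\<^sub>j s\<^sub>i\<close>, with determinant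
  \<open>c\<^sup>2 (1 - q\<^sup>2)\<close>. It is solved when \<open>q\<^sup>2 \<noteq> 1\<close>, which leads to cube roots of \<open>(c (1 + q))\<^sup>3\<close>; in the degenerate
  cases \<open>q = 1\<close> and \<open>q = -1\<close> its left-hand sides are antisymmetric and symmetric.
\<close>

lemma q_commuting_coefficients:
  fixes a b c q :: "'k::field"
  assumes two: "(2 :: 'k) \<noteq> 0" and c: "c \<noteq> 0" and ell: "(3 * a * b * c) ^ 3 \<noteq> (a ^ 3 + b ^ 3 + c ^ 3) ^ 3"
    and eqs: "c * (p2 * s3 - q * (s2 * p3)) = a * (p1 * s1 - q * (s1 * p1))"
      "c * (p3 * s2 - q * (s3 * p2)) = b * (p1 * s1 - q * (s1 * p1))"
      "c * (p3 * s1 - q * (s3 * p1)) = a * (p2 * s2 - q * (s2 * p2))"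
      "c * (p1 * s3 - q * (s1 * p3)) = b * (p2 * s2 - q * (s2 * p2))"
      "c * (p1 * s2 - q * (s1 * p2)) = a * (p3 * s3 - q * (s3 * p3))"
      "c * (p2 * s1 - q * (s2 * p1)) = b * (p3 * s3 - q * (s3 * p3))"
    and indep: "\<not> (p2 * s3 = p3 * s2 \<and> p3 * s1 = p1 * s3 \<and> p1 * s2 = p2 * s1)"
  shows "q = - 1 \<and> a = b"
proof -
  have q1: "q \<noteq> 1"
  proof
    assume "q = 1"
    with eqs c have "p2 * s3 - s2 * p3 = 0" "p3 * s1 - s3 * p1 = 0" "p1 * s2 - s1 * p2 = 0" by simp_all
    with indep show False by (simp add: mult.commute)
  qed
  have "q = - 1"
  proof (rule ccontr)
    assume q: "q \<noteq> - 1"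
    then have q': "1 + q \<noteq> 0" by (metis add.commute add_eq_0_iff)
    \<comment> \<open>Cramer's rule, after cancelling the factor \<open>1 - q\<close> of the determinant\<close>
    have solve: "c * (1 + q) * A = (a + q * b) * P" "c * (1 + q) * B = (b + q * a) * P"
      if "c * (A - q * B) = a * (P - q * P)" "c * (B - q * A) = b * (P - q * P)" for A B P
    proof -
      have "(1 - q) * (c * (1 + q) * A) = c * (A - q * B) + q * (c * (B - q * A))" by (simp add: algebra_simps)
      also have "\<dots> = (1 - q) * ((a + q * b) * P)" unfolding that by (simp add: algebra_simps)
      finally show "c * (1 + q) * A = (a + q * b) * P" using q1 by simp
      have "(1 - q) * (c * (1 + q) * B) = q * (c * (A - q * B)) + c * (B - q * A)" by (simp add: algebra_simps)
      also have "\<dots> = (1 - q) * ((b + q * a) * P)" unfolding that by (simp add: algebra_simps)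
      finally show "c * (1 + q) * B = (b + q * a) * P" using q1 by simp
    qed
    define e u v where "e = c * (1 + q)" and "u = a + q * b" and "v = b + q * a"
    have e0: "e \<noteq> 0" using c q' by (simp add: e_def)
    note sol = solve[of "p2 * s3" "p3 * s2" "p1 * s1"] solve[of "p3 * s1" "p1 * s3" "p2 * s2"]
      solve[of "p1 * s2" "p2 * s1" "p3 * s3"]
    have *: "e * (p2 * s3) = u * (p1 * s1)" "e * (p3 * s1) = u * (p2 * s2)" "e * (p1 * s2) = u * (p3 * s3)"
      "e * (p3 * s2) = v * (p1 * s1)" "e * (p1 * s3) = v * (p2 * s2)" "e * (p2 * s1) = v * (p3 * s3)"
      unfolding e_def u_def v_def by (rule sol; use eqs in \<open>simp add: mult.commute\<close>)+
    \<comment> \<open>\<open>u + v = (1 + q) (a + b)\<close>, so the sum of the two cube roots determines \<open>(a + b)\<^sup>3\<close>\<close>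
    have "(u + v) ^ 3 = - (e ^ 3)"
      by (rule distinct_cube_roots_sum; rule twisted_products_cube_roots[OF e0 * indep])
    moreover have "(u + v) ^ 3 = (1 + q) ^ 3 * (a + b) ^ 3"
      unfolding power_mult_distrib[symmetric] by (simp add: u_def v_def algebra_simps)
    moreover have "e ^ 3 = (1 + q) ^ 3 * c ^ 3" by (simp add: e_def power_mult_distrib)
    ultimately have "(1 + q) ^ 3 * (a + b) ^ 3 = (1 + q) ^ 3 * (- (c ^ 3))" by simp
    moreover have "(1 + q) ^ 3 \<noteq> 0" using q' by simp
    ultimately have s: "(a + b) ^ 3 = - (c ^ 3)" by (metis mult_left_cancel)
    have "a ^ 3 + b ^ 3 + c ^ 3 = - (3 * a * b * (a + b)) + ((a + b) ^ 3 + c ^ 3)"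
      by (simp add: power3_eq_cube algebra_simps)
    then have "a ^ 3 + b ^ 3 + c ^ 3 = - (3 * a * b * (a + b))" by (simp add: s)
    then have "(a ^ 3 + b ^ 3 + c ^ 3) ^ 3 = - ((3 * a * b) ^ 3 * (a + b) ^ 3)"
      by (simp add: power_mult_distrib)
    also have "\<dots> = (3 * a * b * c) ^ 3" by (simp add: s power_mult_distrib)
    finally show False using ell by simp
  qed
  moreover have "a = b"
  proof (rule ccontr)
    assume ab: "a \<noteq> b"
    have zero: "P = 0 \<and> A + B = 0" if "c * (A + B) = a * (P + P)" "c * (A + B) = b * (P + P)" for A B P
    proof -
      have "(a - b) * (2 * P) = 0" using that by (simp add: algebra_simps)
      with ab two have "P = 0" by simp
      with that c show ?thesis by simp
    qed
    have "p1 * s1 = 0 \<and> p2 * s3 + s2 * p3 = 0" "p2 * s2 = 0 \<and> p3 * s1 + s3 * p1 = 0"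
      "p3 * s3 = 0 \<and> p1 * s2 + s1 * p2 = 0"
      by (rule zero; use eqs \<open>q = - 1\<close> in \<open>simp add: ac_simps\<close>)+
    \<comment> \<open>the commutative product of the two forms is zero, so one of them is\<close>
    with indep show False
      by (cases "p1 = 0"; cases "p2 = 0"; cases "p3 = 0") auto
  qed
  ultimately show ?thesis by simp
qed

text \<open>
  If \<open>p = k s\<close>, division by \<open>2k\<close> turns the equations into \<open>c s\<^sub>2 s\<^sub>3 = s\<^sub>1\<^sup>2\<close> and its rotations, whose product is
  \<open>c\<^sup>3 P\<^sup>2 = P\<^sup>2\<close> for \<open>P = s\<^sub>1 s\<^sub>2 s\<^sub>3\<close>; and \<open>P = 0\<close> forces \<open>s = 0\<close>.
\<close>

lemma anticommuting_coefficients_independent: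
  fixes c :: "'k::field" and p s :: "'k ^ 3"
  assumes two: "(2 :: 'k) \<noteq> 0" and c: "c ^ 3 \<noteq> 1"
    and eqs: "c * (p $ 2 * s $ 3 + p $ 3 * s $ 2) = 2 * p $ 1 * s $ 1"
      "c * (p $ 3 * s $ 1 + p $ 1 * s $ 3) = 2 * p $ 2 * s $ 2"
      "c * (p $ 1 * s $ 2 + p $ 2 * s $ 1) = 2 * p $ 3 * s $ 3"
    and p: "p \<noteq> 0"
  shows "p \<noteq> k *s s"
proof
  assume ps: "p = k *s s"
  with p have k: "k \<noteq> 0" by auto
  have cancel: "c * (y * z) = x * x"
    if "c * (k * y * z + k * z * y) = 2 * (k * x) * x" for x y z
  proof -
    from that have "(2 * k) * (c * (y * z)) = (2 * k) * (x * x)" by (simp add: algebra_simps)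
    with two k show ?thesis by simp
  qed
  have sq: "c * (s $ 2 * s $ 3) = s $ 1 * s $ 1" "c * (s $ 3 * s $ 1) = s $ 2 * s $ 2"
    "c * (s $ 1 * s $ 2) = s $ 3 * s $ 3"
    by (rule cancel; use eqs in \<open>simp add: ps\<close>)+
  have "s \<noteq> 0" using ps p by auto
  then have nz: "s $ 1 * s $ 2 * s $ 3 \<noteq> 0"
    using sq by (auto simp: vec_eq_iff forall_3)
  have "(c * (s $ 2 * s $ 3)) * (c * (s $ 3 * s $ 1)) * (c * (s $ 1 * s $ 2)) =
    (s $ 1 * s $ 1) * (s $ 2 * s $ 2) * (s $ 3 * s $ 3)" by (simp only: sq)
  then have "c ^ 3 * (s $ 1 * s $ 2 * s $ 3) ^ 2 = (s $ 1 * s $ 2 * s $ 3) ^ 2"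
    by (simp add: power2_eq_square power3_eq_cube mult_ac)
  with nz c show False by simp
qed

section \<open>Anticommuting pairs up to scaling\<close>

lemma multilinearization_scale:
  "multilinearization f (k *s p) (l *s q) = k * l * multilinearization f p q"
  by (simp add: multilinearization_def sum_distrib_left mult_ac)

text \<open>
  Quadratic relations let coefficient vectors be recovered from the linear forms, so scaling a pair \<open>(r, s)\<close>
  componentwise is the same as moving the two coefficient vectors on their lines. The bijection sends a
  class to the set of first and the set of second coefficient vectors of its members, which are these lines.
\<close>

lemma anticomm_pairs_bij_Gamma_points:
  fixes R R' :: "('v::finite, 'k::field) free_alg set"
  assumes hom: "\<And>f. f \<in> R \<Longrightarrow> homogeneous 2 f"
    and iff: "\<And>p q. (pres_linform R p, pres_linform R q) \<in> anticomm_pairs R \<longleftrightarrow>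
      p \<noteq> 0 \<and> q \<noteq> 0 \<and> (\<forall>f\<in>R'. multilinearization f p q = 0)"
  shows "\<exists>\<phi>. bij_betw \<phi> (anticomm_pairs R // pair_scaling R) (Gamma_points R') \<and>
    (\<forall>p q. (pres_linform R p, pres_linform R q) \<in> anticomm_pairs R \<longrightarrow>
      \<phi> (pair_scaling R `` {(pres_linform R p, pres_linform R q)}) = (proj_pt p, proj_pt q))"
proof -
  let ?L = "pres_linform R" and ?A = "anticomm_pairs R" and ?S = "pair_scaling R"
  define \<phi> where "\<phi> P = ({p. \<exists>s. (?L p, s) \<in> P}, {q. \<exists>r. (r, ?L q) \<in> P})" for P
  have lin: "\<exists>p q. x = (?L p, ?L q)" if "x \<in> ?A" for x
    using that by (auto simp: anticomm_pairs_def pres_degree_one simp del: One_nat_def)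
  have cls_lin: "\<exists>p q. P = ?S `` {(?L p, ?L q)} \<and> (?L p, ?L q) \<in> ?A" if "P \<in> ?A // ?S" for P
  proof -
    from that obtain x where "x \<in> ?A" "P = ?S `` {x}" by (rule quotientE)
    with lin[of x] show ?thesis by blast
  qed
  have scaled: "(?L (k *s p), ?L (l *s q)) \<in> ?A" if "(?L p, ?L q) \<in> ?A" "k \<noteq> 0" "l \<noteq> 0" for p q k l
    using that unfolding iff by (simp add: multilinearization_scale)
  have cls: "?S `` {(?L p, ?L q)} = {(?L p', ?L q') | p' q'. p' \<in> proj_pt p \<and> q' \<in> proj_pt q}"
    if "(?L p, ?L q) \<in> ?A" for p q
    using that scaled[OF that] by (auto simp: pair_scaling_def pres_scalar_linform proj_pt_def)
  have self: "p \<in> proj_pt p" for p :: "'k ^ 'v"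
    by (auto simp: proj_pt_def intro!: exI[of _ 1])
  have \<phi>: "\<phi> (?S `` {(?L p, ?L q)}) = (proj_pt p, proj_pt q)" if "(?L p, ?L q) \<in> ?A" for p q
    using self[of p] self[of q] by (auto simp: \<phi>_def cls[OF that] pres_linform_eq_iff[OF hom])
  have "bij_betw \<phi> (?A // ?S) (Gamma_points R')"
    unfolding bij_betw_def
  proof
    show "inj_on \<phi> (?A // ?S)"
    proof (rule inj_onI)
      fix P Q assume P: "P \<in> ?A // ?S" and Q: "Q \<in> ?A // ?S" and eq: "\<phi> P = \<phi> Q"
      from cls_lin[OF P] cls_lin[OF Q] obtain p q p' q' where "P = ?S `` {(?L p, ?L q)}" "(?L p, ?L q) \<in> ?A"
        "Q = ?S `` {(?L p', ?L q')}" "(?L p', ?L q') \<in> ?A"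
        by blast
      with eq show "P = Q" by (simp add: \<phi>) (simp add: cls)
    qed
    show "\<phi> ` (?A // ?S) = Gamma_points R'"
    proof
      show "\<phi> ` (?A // ?S) \<subseteq> Gamma_points R'"
      proof
        fix y assume "y \<in> \<phi> ` (?A // ?S)"
        then obtain P where P: "P \<in> ?A // ?S" and y: "y = \<phi> P" by blast
        from cls_lin[OF P] y obtain p q where "y = \<phi> (?S `` {(?L p, ?L q)})" and pq: "(?L p, ?L q) \<in> ?A"
          by blast
        then show "y \<in> Gamma_points R'"
          using iff[of p q] by (auto simp: \<phi> Gamma_points_def)
      qed
      show "Gamma_points R' \<subseteq> \<phi> ` (?A // ?S)"
      proof
        fix y assume "y \<in> Gamma_points R'"
        then obtain p q where "y = (proj_pt p, proj_pt q)" and pq: "(?L p, ?L q) \<in> ?A"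
          unfolding iff Gamma_points_def by blast
        then show "y \<in> \<phi> ` (?A // ?S)"
          by (intro image_eqI[of _ _ "?S `` {(?L p, ?L q)}"]) (simp_all add: \<phi> quotientI)
      qed
    qed
  qed
  with \<phi> show ?thesis by blast
qed

section \<open>Pairs of linear forms that commute up to a scalar\<close>

lemma of_type_EC_imp:
  fixes a b c :: "'k::alg_closed_field"
  assumes "CHAR('k) \<noteq> 3" and "is_type_EC a b c"
  shows "c \<noteq> 0" and "(3 * a * b * c) ^ 3 \<noteq> (a ^ 3 + b ^ 3 + c ^ 3) ^ 3"
    and "\<not> (a ^ 3 = b ^ 3 \<and> b ^ 3 = c ^ 3)"
  using assms by (auto simp: is_type_EC_def is_sklyanin_def point_scheme_elliptic_iff)

lemma two_neq_zero:
  assumes "CHAR('k::field) \<noteq> 2"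
  shows "(2 :: 'k) \<noteq> 0"
proof
  assume "(2 :: 'k) = 0"
  then have "of_nat 2 = (0 :: 'k)" by simp
  then have "CHAR('k) dvd 2" by (simp only: of_nat_eq_0_iff_char_dvd)
  moreover have "Factorial_Ring.prime (2 :: nat)" by simp
  moreover have "CHAR('k) \<noteq> 1" by simp
  ultimately show False using assms by (metis prime_nat_iff)
qed

lemma q_commuting_linear_forms:
  fixes a b c q :: "'k::alg_closed_field"
  assumes char: "CHAR('k) \<noteq> 2" "CHAR('k) \<noteq> 3" and EC: "is_type_EC a b c"
  defines "R \<equiv> sklyanin_rels a b c"
  assumes indep: "pres_independent R [pres_linform R p, pres_linform R s]"
    and comm: "pres_linform R p \<otimes>\<^bsub>pres_alg R\<^esub> pres_linform R s =
      pres_scalar R q \<otimes>\<^bsub>pres_alg R\<^esub> (pres_linform R s \<otimes>\<^bsub>pres_alg R\<^esub> pres_linform R p)"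
  shows "q = - 1 \<and> a = b"
proof -
  note EC' = of_type_EC_imp[OF char(2) EC]
  have "pres_independent R [pres_linform R p, pres_linform R s] \<longleftrightarrow> s \<noteq> 0 \<and> (\<forall>k. p \<noteq> k *s s)"
    unfolding R_def by (rule pres_independent_linforms[OF homogeneous_sklyanin_rels])
  with indep have minors: "\<not> (p $ 2 * s $ 3 = p $ 3 * s $ 2 \<and> p $ 3 * s $ 1 = p $ 1 * s $ 3 \<and>
      p $ 1 * s $ 2 = p $ 2 * s $ 1)"
    using vanishing_minors_proportional by blast
  note eqs = comm[unfolded R_def sklyanin_commutation_iff[OF EC'(1)]]
  show ?thesis
    by (rule q_commuting_coefficients[OF two_neq_zero[OF char(1)] EC'(1,2) _ _ _ _ _ _ minors])
      (use eqs in blast)+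
qed

text \<open>
  For \<open>a = b = 1\<close> and \<open>q = -1\<close> the six commutation equations coincide in pairs, and the three that remain
  define \<open>\<Gamma>(S(-c,-c,2))\<close>. Independence may be replaced by
  nonvanishing, because proportional nonzero solutions occur only if \<open>c\<^sup>3 = 1\<close>.
\<close>

lemma anticomm_pairs_iff_Gamma:
  fixes c :: "'k::alg_closed_field" and p s :: "'k ^ 3"
  assumes char: "CHAR('k) \<noteq> 2" "CHAR('k) \<noteq> 3" and EC: "is_type_EC 1 1 c"
  defines "R \<equiv> sklyanin_rels 1 1 c"
  shows "(pres_linform R p, pres_linform R s) \<in> anticomm_pairs R \<longleftrightarrow>
    p \<noteq> 0 \<and> s \<noteq> 0 \<and> (\<forall>f\<in>sklyanin_rels (- c) (- c) 2. multilinearization f p s = 0)"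
proof -
  note EC' = of_type_EC_imp[OF char(2) EC]
  let ?E = "c * (p $ 2 * s $ 3 + p $ 3 * s $ 2) = 2 * p $ 1 * s $ 1 \<and>
    c * (p $ 3 * s $ 1 + p $ 1 * s $ 3) = 2 * p $ 2 * s $ 2 \<and>
    c * (p $ 1 * s $ 2 + p $ 2 * s $ 1) = 2 * p $ 3 * s $ 3"
  have minus: "\<ominus>\<^bsub>pres_alg R\<^esub> (pres_linform R s \<otimes>\<^bsub>pres_alg R\<^esub> pres_linform R p) =
      pres_scalar R (- 1) \<otimes>\<^bsub>pres_alg R\<^esub> (pres_linform R s \<otimes>\<^bsub>pres_alg R\<^esub> pres_linform R p)"
    by (simp add: pres_linform_eq pres_class_mult pres_uminus_eq_scalar)
  have indep: "pres_independent R [pres_linform R p, pres_linform R s] \<longleftrightarrow> s \<noteq> 0 \<and> (\<forall>k. p \<noteq> k *s s)"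
    unfolding R_def by (rule pres_independent_linforms[OF homogeneous_sklyanin_rels])
  have symmetrize: "c * (x * y' - - 1 * (x' * y)) = 1 * (z * z' - - 1 * (z' * z)) \<longleftrightarrow>
      c * (x * y' + y * x') = 2 * z * z'" for x y z x' y' z'
    by (simp add: algebra_simps)
  have gamma: "- c * y * z' + - c * z * y' + 2 * x * x' = 0 \<longleftrightarrow> c * (y * z' + z * y') = 2 * x * x'"
    for x y z x' y' z'
  proof -
    have "- c * y * z' + - c * z * y' + 2 * x * x' = 2 * x * x' - c * (y * z' + z * y')"
      by (simp add: algebra_simps)
    then show ?thesis by (metis right_minus_eq)
  qed
  have "(pres_linform R p, pres_linform R s) \<in> anticomm_pairs R \<longleftrightarrow>
    (s \<noteq> 0 \<and> (\<forall>k. p \<noteq> k *s s)) \<and>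
    pres_linform R p \<otimes>\<^bsub>pres_alg R\<^esub> pres_linform R s =
      pres_scalar R (- 1) \<otimes>\<^bsub>pres_alg R\<^esub> (pres_linform R s \<otimes>\<^bsub>pres_alg R\<^esub> pres_linform R p)"
    unfolding anticomm_pairs_def pres_degree_one mem_Collect_eq case_prod_conv indep minus by blast
  also have "\<dots> \<longleftrightarrow> (s \<noteq> 0 \<and> (\<forall>k. p \<noteq> k *s s)) \<and> ?E"
    unfolding R_def sklyanin_commutation_iff[OF EC'(1)] symmetrize by (auto simp only: add.commute)
  also have "\<dots> \<longleftrightarrow> p \<noteq> 0 \<and> s \<noteq> 0 \<and> ?E"
  proof -
    have "p \<noteq> 0" if "\<forall>k. p \<noteq> k *s s" using spec[OF that, of 0] by simp
    moreover have "p \<noteq> k *s s" if ?E "p \<noteq> 0" for k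
      using anticommuting_coefficients_independent[OF two_neq_zero[OF char(1)] _ _ _ _ that(2)] EC'(3) that(1)
      by simp
    ultimately show ?thesis by blast
  qed
  also have "?E \<longleftrightarrow> (\<forall>f\<in>sklyanin_rels (- c) (- c) 2. multilinearization f p s = 0)"
    unfolding multilinearization_sklyanin_rels gamma by blast
  finally show ?thesis .
qed

text \<open>
  For a fixed first vector the equations of \<open>\<Gamma>(S(-c,-c,2))\<close> are linear in the second, with a symmetric
  matrix whose determinant is a combination of \<open>xyz\<close> and \<open>x\<^sup>3 + y\<^sup>3 + z\<^sup>3\<close> at the first vector. Both
  vanish at \<open>(0, 1, -1)\<close>, and \<open>(-2, c, c)\<close> spans the kernel there.
\<close>

lemma anticomm_pair_exists:
  fixes c :: "'k::alg_closed_field"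
  assumes "CHAR('k) \<noteq> 2" "CHAR('k) \<noteq> 3" and "is_type_EC 1 1 c"
  shows "\<exists>r s. (r, s) \<in> anticomm_pairs (sklyanin_rels 1 1 c)"
proof -
  have "(vector [0, 1, - 1] :: 'k ^ 3) \<noteq> 0" "(vector [- 2, c, c] :: 'k ^ 3) \<noteq> 0"
    using of_type_EC_imp(1)[OF assms(2,3)] by (auto simp: vec_eq_iff forall_3)
  moreover have "\<forall>f\<in>sklyanin_rels (- c) (- c) 2.
      multilinearization f (vector [0, 1, - 1]) (vector [- 2, c, c]) = 0"
    unfolding multilinearization_sklyanin_rels by simp
  ultimately show ?thesis
    using anticomm_pairs_iff_Gamma[OF assms, of "vector [0, 1, - 1]" "vector [- 2, c, c]"] by blast
qed

theorem theorem6p2: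
  assumes "CHAR('k::alg_closed_field) \<noteq> 2" and "CHAR('k) \<noteq> 3"
  shows
    "(\<forall>(a::'k) b c. is_type_EC a b c \<longrightarrow>
        (\<forall>r \<in> pres_degree (sklyanin_rels a b c) 1. \<forall>s \<in> pres_degree (sklyanin_rels a b c) 1. \<forall>q.
          pres_independent (sklyanin_rels a b c) [r, s] \<and> q \<noteq> 0 \<and>
          r \<otimes>\<^bsub>pres_alg (sklyanin_rels a b c)\<^esub> s =
            pres_scalar (sklyanin_rels a b c) q \<otimes>\<^bsub>pres_alg (sklyanin_rels a b c)\<^esub>
              (s \<otimes>\<^bsub>pres_alg (sklyanin_rels a b c)\<^esub> r)
          \<longrightarrow> q = -1 \<and> a = b)) \<and>
     (\<forall>c::'k. is_type_EC 1 1 c \<longrightarrow>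
        (\<exists>r s. (r, s) \<in> anticomm_pairs (sklyanin_rels 1 1 c)) \<and>
        (\<exists>\<phi>. bij_betw \<phi>
               (anticomm_pairs (sklyanin_rels 1 1 c) // pair_scaling (sklyanin_rels 1 1 c))
               (Gamma_points (sklyanin_rels (-c) (-c) 2)) \<and>
             (\<forall>p q. (pres_linform (sklyanin_rels 1 1 c) p, pres_linform (sklyanin_rels 1 1 c) q)
                      \<in> anticomm_pairs (sklyanin_rels 1 1 c) \<longrightarrow>
                \<phi> (pair_scaling (sklyanin_rels 1 1 c) ``
                     {(pres_linform (sklyanin_rels 1 1 c) p, pres_linform (sklyanin_rels 1 1 c) q)})
                  = (proj_pt p, proj_pt q))))"
proof (intro conjI allI impI ballI)
  fix a b c q :: 'k and r s
  let ?R = "sklyanin_rels a b c"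
  assume EC: "is_type_EC a b c" and r: "r \<in> pres_degree ?R 1" and s: "s \<in> pres_degree ?R 1"
    and H: "pres_independent ?R [r, s] \<and> q \<noteq> 0 \<and>
      r \<otimes>\<^bsub>pres_alg ?R\<^esub> s = pres_scalar ?R q \<otimes>\<^bsub>pres_alg ?R\<^esub> (s \<otimes>\<^bsub>pres_alg ?R\<^esub> r)"
  from r s obtain p p' where "r = pres_linform ?R p" "s = pres_linform ?R p'"
    unfolding pres_degree_one by blast
  with H have "q = - 1 \<and> a = b"
    by (intro q_commuting_linear_forms[OF assms EC]) auto
  then show "q = - 1" and "a = b" by simp_all
next
  fix c :: 'k assume "is_type_EC 1 1 c"
  then show "\<exists>r s. (r, s) \<in> anticomm_pairs (sklyanin_rels 1 1 c)"
    by (rule anticomm_pair_exists[OF assms])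
next
  fix c :: 'k assume EC: "is_type_EC 1 1 c"
  show "\<exists>\<phi>. bij_betw \<phi>
               (anticomm_pairs (sklyanin_rels 1 1 c) // pair_scaling (sklyanin_rels 1 1 c))
               (Gamma_points (sklyanin_rels (-c) (-c) 2)) \<and>
             (\<forall>p q. (pres_linform (sklyanin_rels 1 1 c) p, pres_linform (sklyanin_rels 1 1 c) q)
                      \<in> anticomm_pairs (sklyanin_rels 1 1 c) \<longrightarrow>
                \<phi> (pair_scaling (sklyanin_rels 1 1 c) ``
                     {(pres_linform (sklyanin_rels 1 1 c) p, pres_linform (sklyanin_rels 1 1 c) q)})
                  = (proj_pt p, proj_pt q))"
    by (rule anticomm_pairs_bij_Gamma_points[OF homogeneous_sklyanin_rels anticomm_pairs_iff_Gamma[OF assms EC]])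
qed

end
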